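(* Let $s\ge 2$ be an integer and let $\omega=\omega(n)$ be any function with $\omega(n)\to\infty$ as $n\to\infty$ (arbitrarily slowly). Then \[ \mathbf{RT}_s\big(n,K_{2s+1},\mathbf{f}_{s,s+1}(n/\omega)\big)=o(n^2). \]
   Context: For a graph $G$ and integer $s\ge 2$, the $s$-independence number $\alpha_s(G)$ is the maximum number of vertices of an induced subgraph of $G$ containing no copy of $K_s$. For a graph $H$ and a function $f=f(n)$, $\mathbf{RT}_s(n,H,f)$ is the maximum number of edges of an $H$-free graph on $n$ vertices with $\alpha_s(G)<f$ (or $0$ if no such graph exists). The Erdős–Rogers number $\mathbf{f}_{s,t}(m)$ is the minimum of $\alpha_s(G)$ over all $K_t$-free graphs $G$ on $m$ vertices. Rounding of $n/\omega$ is ignored. *)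

theory Defs
  imports "HOL-Library.Landau_Symbols" "HOL-Library.Ramsey"
begin

(* A graph is a pair (vertex set, edge set). *)
type_synonym 'a graph = "'a set \<times> 'a set set"

abbreviation verts :: "'a graph \<Rightarrow> 'a set" where
  "verts G \<equiv> fst G"

abbreviation edges :: "'a graph \<Rightarrow> 'a set set" where
  "edges G \<equiv> snd G"

(* The simple graphs on n vertices, up to isomorphism, are those with vertex set {..<n}. *)
definition graphs_on :: "nat \<Rightarrow> nat graph set" where
  "graphs_on n = {G. verts G = {..<n} \<and> edges G \<subseteq> nsets {..<n} 2}"

definition complete_graph :: "nat \<Rightarrow> nat graph" where
  "complete_graph t = ({..<t}, nsets {..<t} 2)"

definition induced_subgraph :: "'a graph \<Rightarrow> 'a set \<Rightarrow> 'a graph" where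
  "induced_subgraph G W = (W, {e \<in> edges G. e \<subseteq> W})"

(* Copies are not required to be induced. *)
definition contains_copy :: "'a graph \<Rightarrow> 'b graph \<Rightarrow> bool" where
  "contains_copy G H \<longleftrightarrow>
     (\<exists>\<phi>. inj_on \<phi> (verts H) \<and> \<phi> ` verts H \<subseteq> verts G \<and> (\<forall>e\<in>edges H. \<phi> ` e \<in> edges G))"

definition s_independence_number :: "nat \<Rightarrow> 'a graph \<Rightarrow> nat" where
  "s_independence_number s G =
     Max {card W | W. W \<subseteq> verts G \<and> \<not> contains_copy (induced_subgraph G W) (complete_graph s)}"

(* For a real number of vertices n / \<omega>(n), the floor is meant. As \<omega> ranges over all real functions
   tending to infinity, no other rounding would give a more general statement. *)
definition erdos_rogers :: "nat \<Rightarrow> nat \<Rightarrow> nat \<Rightarrow> nat" where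
  "erdos_rogers s t m =
     Min {s_independence_number s G | G. G \<in> graphs_on m \<and> \<not> contains_copy G (complete_graph t)}"

(* The argument f is the value f(n) of the bounding function, which need not be an integer. *)
definition RT :: "nat \<Rightarrow> nat \<Rightarrow> 'b graph \<Rightarrow> real \<Rightarrow> nat" where
  "RT s n H f =
     (let A = {G \<in> graphs_on n. \<not> contains_copy G H \<and> real (s_independence_number s G) < f}
      in if A = {} then 0 else Max ((\<lambda>G. card (edges G)) ` A))"

end

theory Submission
  imports Defs
begin

text \<open>
  Let G have at least \<open>c n\<^sup>2\<close> edges and \<open>\<alpha>\<^sub>s(G) < b\<close>, where b is the Erdos--Rogers number of
  \<open>m = n / \<omega>\<close>. Every m vertices of G span a \<open>K\<^bsub>s+1\<^esub>\<close>, and every b vertices span a \<open>K\<^sub>s\<close>; so G contains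
  \<open>K\<^bsub>2s+1\<^esub>\<close> once some m vertices are such that any s + 1 of them have at least b common neighbours.
  The common neighbourhood of t random vertices is such a set: it has linear expected size, while a
  fixed set of s + 1 vertices with fewer than b common neighbours lies in it with probability at most
  \<open>(b/n)\<^sup>t\<close>. This beats the \<open>n\<^bsup>s+1\<^esup>\<close> choices for a large constant t because b is at most \<open>n\<^bsup>1-\<delta>\<^esup>\<close>.
  The last bound comes from words of length N over s letters, two of them adjacent if they agree in
  fewer than 2N/(s(s+1)) positions: there is no \<open>K\<^bsub>s+1\<^esub>\<close> by pigeonhole, and concentration of measure
  gives a \<open>K\<^sub>s\<close> in every set of words that is not exponentially sparse.
\<close>

section \<open>Cliques, and the two graph parameters in terms of cliques\<close>

definition pairwise_adjacent :: "'a set set \<Rightarrow> 'a set \<Rightarrow> bool" where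
  "pairwise_adjacent E S \<longleftrightarrow> (\<forall>x\<in>S. \<forall>y\<in>S. x \<noteq> y \<longrightarrow> {x, y} \<in> E)"

text \<open>Edge set and vertex set are separate arguments: passing to an induced subgraph changes
  only \<open>W\<close>, and the same notion serves graphs on numbers and on words.\<close>

definition has_clique :: "nat \<Rightarrow> 'a set set \<Rightarrow> 'a set \<Rightarrow> bool" where
  "has_clique s E W \<longleftrightarrow> (\<exists>S\<subseteq>W. finite S \<and> card S = s \<and> pairwise_adjacent E S)"

lemma contains_copy_complete_graph_iff:
  "contains_copy G (complete_graph s) \<longleftrightarrow> has_clique s (edges G) (verts G)"
proof
  assume "contains_copy G (complete_graph s)"
  then obtain \<phi> where inj: "inj_on \<phi> {..<s}" and sub: "\<phi> ` {..<s} \<subseteq> verts G"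
    and edge: "\<forall>e\<in>nsets {..<s} 2. \<phi> ` e \<in> edges G"
    unfolding contains_copy_def complete_graph_def by auto
  have "{\<phi> i, \<phi> j} \<in> edges G" if "i < s" "j < s" "\<phi> i \<noteq> \<phi> j" for i j
  proof -
    have "{i, j} \<in> nsets {..<s} 2"
      using that by (auto simp: nsets_def card_insert_if)
    then have "\<phi> ` {i, j} \<in> edges G" using edge by blast
    then show ?thesis by simp
  qed
  then have "pairwise_adjacent (edges G) (\<phi> ` {..<s})"
    by (auto simp: pairwise_adjacent_def)
  then show "has_clique s (edges G) (verts G)"
    using sub card_image[OF inj] unfolding has_clique_def by (intro exI[of _ "\<phi> ` {..<s}"]) auto
next
  assume "has_clique s (edges G) (verts G)"
  then obtain S where S: "S \<subseteq> verts G" "finite S" "card S = s" "pairwise_adjacent (edges G) S"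
    unfolding has_clique_def by blast
  then obtain \<phi> where bij: "bij_betw \<phi> {..<s} S"
    using ex_bij_betw_nat_finite[of S] by (auto simp: lessThan_atLeast0)
  have "\<phi> ` e \<in> edges G" if "e \<in> nsets {..<s} 2" for e
  proof -
    obtain i j where e: "e = {i, j}" "i \<noteq> j" and "i < s" "j < s"
      using \<open>e \<in> nsets {..<s} 2\<close> by (auto simp: nsets_def card_2_iff)
    then have "\<phi> i \<noteq> \<phi> j" "\<phi> i \<in> S" "\<phi> j \<in> S"
      using bij_betw_apply[OF bij] bij_betw_imp_inj_on[OF bij] by (simp_all add: inj_on_eq_iff)
    then show ?thesis using S(4) by (simp add: e pairwise_adjacent_def)
  qed
  then show "contains_copy G (complete_graph s)"
    using bij S(1) unfolding contains_copy_def complete_graph_def bij_betw_def by auto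
qed

lemma has_clique_mono: "has_clique s E W \<Longrightarrow> W \<subseteq> W' \<Longrightarrow> has_clique s E W'"
  unfolding has_clique_def by blast

lemma has_clique_edges_within: "has_clique s {e \<in> E. e \<subseteq> W} W \<longleftrightarrow> has_clique s E W"
  unfolding has_clique_def pairwise_adjacent_def by (rule ex_cong1) auto

text \<open>This assembles a \<open>K_{2s+1}\<close> from a \<open>K_{s+1}\<close> and a
  \<open>K_s\<close> in its common neighbourhood. The condition \<open>x \<noteq> y\<close> keeps
  the two cliques disjoint, so that their sizes add up.\<close>

lemma has_clique_Un:
  assumes K: "finite K" "card K = a" "pairwise_adjacent E K"
    and L: "has_clique b E W"
    and joined: "\<And>x y. x \<in> K \<Longrightarrow> y \<in> W \<Longrightarrow> x \<noteq> y \<and> {x, y} \<in> E"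
  shows "has_clique (a + b) E (K \<union> W)"
proof -
  obtain L where L: "L \<subseteq> W" "finite L" "card L = b" "pairwise_adjacent E L"
    using L unfolding has_clique_def by blast
  have "K \<inter> L = {}" using joined L(1) by blast
  then have "card (K \<union> L) = a + b" using K L by (simp add: card_Un_disjoint)
  moreover have "pairwise_adjacent E (K \<union> L)"
    unfolding pairwise_adjacent_def
  proof (intro ballI impI)
    fix x y assume xy: "x \<in> K \<union> L" "y \<in> K \<union> L" "x \<noteq> y"
    consider "x \<in> K" "y \<in> K" | "x \<in> L" "y \<in> L" | "x \<in> K" "y \<in> L" | "y \<in> K" "x \<in> L"
      using xy by blast
    then show "{x, y} \<in> E"
    proof cases
      case 1
      then show ?thesis using K(3) xy(3) by (simp add: pairwise_adjacent_def)
    next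
      case 2
      then show ?thesis using L(4) xy(3) by (simp add: pairwise_adjacent_def)
    next
      case 3
      then show ?thesis using joined[of x y] L(1) by blast
    next
      case 4
      then show ?thesis using joined[of y x] L(1) by (metis insert_commute subsetD)
    qed
  qed
  ultimately show ?thesis
    using K(1) L(1,2) unfolding has_clique_def by (intro exI[of _ "K \<union> L"]) auto
qed

lemma s_independence_number_eq:
  "s_independence_number s G = Max {card W | W. W \<subseteq> verts G \<and> \<not> has_clique s (edges G) W}"
  unfolding s_independence_number_def contains_copy_complete_graph_iff
  by (simp add: induced_subgraph_def has_clique_edges_within)

lemma finite_cards_subsets: "finite A \<Longrightarrow> finite {card W | W. W \<subseteq> A \<and> P W}"
  by (rule finite_subset[of _ "card ` Pow A"]) auto

lemma card_le_s_independence_number: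
  assumes "finite (verts G)" "W \<subseteq> verts G" "\<not> has_clique s (edges G) W"
  shows "card W \<le> s_independence_number s G"
  unfolding s_independence_number_eq
  by (rule Max_ge) (use assms finite_cards_subsets in auto)

lemma s_independence_number_le:
  assumes "finite (verts G)" "0 < s"
    and "\<And>W. W \<subseteq> verts G \<Longrightarrow> \<not> has_clique s (edges G) W \<Longrightarrow> card W \<le> b"
  shows "s_independence_number s G \<le> b"
proof -
  \<comment> \<open>The empty set competes in the maximum because \<open>0 < s\<close>, so the
    maximum is over a nonempty set.\<close>
  have "\<not> has_clique s (edges G) {}"
    using \<open>0 < s\<close> by (auto simp: has_clique_def)
  then show ?thesis
    unfolding s_independence_number_eq using assms(3)
    by (subst Max_le_iff) (use assms(1) in \<open>auto simp: finite_cards_subsets\<close>)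
qed

lemma finite_graphs_on: "finite (graphs_on n)"
proof (rule finite_subset)
  show "graphs_on n \<subseteq> {{..<n}} \<times> Pow (nsets {..<n} 2)"
    by (auto simp: graphs_on_def)
qed (simp add: finite_imp_finite_nsets)

text \<open>The witness graph may live on any finite set, here later on words; a bijection carries
  it to \<open>{..<m}\<close>, where it takes part in the minimum.\<close>

lemma erdos_rogers_le:
  fixes U :: "'a set"
  assumes "finite U" "card U = m" "0 < s"
    and free: "\<not> has_clique t E U"
    and small: "\<And>W. W \<subseteq> U \<Longrightarrow> \<not> has_clique s E W \<Longrightarrow> card W \<le> b"
  shows "erdos_rogers s t m \<le> b"
proof -
  obtain h where h: "bij_betw h {..<m} U"
    using assms(1,2) ex_bij_betw_nat_finite[of U] by (auto simp: lessThan_atLeast0)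
  \<comment> \<open>Keeping only two-element sets gives a simple graph whatever \<open>E\<close>
    contains; cliques involve no other edges.\<close>
  define E' where "E' = {e \<in> nsets {..<m} 2. h ` e \<in> E}"
  let ?G = "({..<m}, E')"
  have inj: "inj_on h W" if "W \<subseteq> {..<m}" for W
    using h that by (auto simp: bij_betw_def inj_on_subset)
  have clique_iff: "has_clique r E' W \<longleftrightarrow> has_clique r E (h ` W)" if W: "W \<subseteq> {..<m}" for r W
  proof -
    have adj: "pairwise_adjacent E' S \<longleftrightarrow> pairwise_adjacent E (h ` S)" if "S \<subseteq> W" for S
    proof -
      have edge: "{x, y} \<in> E' \<longleftrightarrow> {h x, h y} \<in> E" if "x \<in> S" "y \<in> S" "x \<noteq> y" for x y
        using that \<open>S \<subseteq> W\<close> W by (auto simp: E'_def nsets_def card_insert_if)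
      have "h x = h y \<longleftrightarrow> x = y" if "x \<in> S" "y \<in> S" for x y
        using inj[of S] that \<open>S \<subseteq> W\<close> W by (auto simp: inj_on_def)
      then show ?thesis using edge by (auto simp: pairwise_adjacent_def)
    qed
    show ?thesis
    proof
      assume "has_clique r E' W"
      then obtain S where S: "S \<subseteq> W" "finite S" "card S = r" "pairwise_adjacent E' S"
        unfolding has_clique_def by blast
      have "card (h ` S) = r" using inj[of S] S W by (simp add: card_image)
      then show "has_clique r E (h ` W)"
        using S adj[of S] unfolding has_clique_def by (intro exI[of _ "h ` S"]) auto
    next
      assume "has_clique r E (h ` W)"
      then obtain S where S: "S \<subseteq> W" "finite (h ` S)" "card (h ` S) = r" "pairwise_adjacent E (h ` S)"
        unfolding has_clique_def by (metis subset_imageE)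
      have "card S = r" "finite S"
        using inj[of S] S W by (simp_all add: card_image finite_image_iff)
      then show "has_clique r E' W"
        using S adj[of S] unfolding has_clique_def by blast
    qed
  qed
  have "h ` {..<m} = U" using h by (simp add: bij_betw_def)
  then have "\<not> contains_copy ?G (complete_graph t)"
    using free clique_iff[of "{..<m}"] by (simp add: contains_copy_complete_graph_iff)
  moreover have "?G \<in> graphs_on m" by (auto simp: graphs_on_def E'_def)
  moreover have "finite {s_independence_number s G | G.
      G \<in> graphs_on m \<and> \<not> contains_copy G (complete_graph t)}"
    by (rule finite_subset[OF _ finite_imageI[OF finite_graphs_on[of m]]]) blast
  ultimately have "erdos_rogers s t m \<le> s_independence_number s ?G"
    unfolding erdos_rogers_def by (intro Min_le) blast+
  also have "\<dots> \<le> b"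
  proof (rule s_independence_number_le)
    fix W assume W: "W \<subseteq> verts ?G" "\<not> has_clique s (edges ?G) W"
    then have "card (h ` W) \<le> b"
      using clique_iff[of W] h by (intro small) (auto simp: bij_betw_def)
    then show "card W \<le> b" using inj[of W] W by (simp add: card_image)
  qed (use \<open>0 < s\<close> in auto)
  finally show ?thesis .
qed

text \<open>Otherwise m vertices of \<open>W\<close> would span a \<open>K_t\<close>-free graph. Its
  \<open>K_s\<close>-free sets are also \<open>K_s\<close>-free in G, so it would bring the
  Erdos-Rogers minimum down to the independence number of G.\<close>

lemma has_clique_if_s_independence_number_less:
  assumes G: "finite (verts G)" "0 < s"
    and less: "s_independence_number s G < erdos_rogers s t m"
    and W: "W \<subseteq> verts G" "m \<le> card W"
  shows "has_clique t (edges G) W"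
proof (rule ccontr)
  assume no: "\<not> has_clique t (edges G) W"
  obtain U where U: "U \<subseteq> W" "card U = m" "finite U"
    using W(2) obtain_subset_with_card_n by blast
  have "erdos_rogers s t m \<le> s_independence_number s G"
  proof (rule erdos_rogers_le)
    show "\<not> has_clique t (edges G) U" using no U(1) has_clique_mono by blast
    show "card X \<le> s_independence_number s G" if "X \<subseteq> U" "\<not> has_clique s (edges G) X" for X
      using that U W G by (intro card_le_s_independence_number) auto
  qed (use U G in auto)
  then show False using less by simp
qed


section \<open>Words with few agreements\<close>

definition words :: "nat \<Rightarrow> nat \<Rightarrow> nat list set" where
  "words s N = {x. set x \<subseteq> {..<s} \<and> length x = N}"

definition hamming :: "nat list \<Rightarrow> nat list \<Rightarrow> nat" where
  "hamming x y = card {i. i < length x \<and> x ! i \<noteq> y ! i}"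

definition agree :: "nat list \<Rightarrow> nat list \<Rightarrow> nat" where
  "agree x y = card {i. i < length x \<and> x ! i = y ! i}"

lemma finite_words [simp]: "finite (words s N)"
  unfolding words_def by (simp add: finite_lists_length_eq)

lemma card_words: "card (words s N) = s ^ N"
  unfolding words_def by (simp add: card_lists_length_eq)

lemma length_words: "x \<in> words s N \<Longrightarrow> length x = N"
  by (simp add: words_def)

lemma nth_words: "x \<in> words s N \<Longrightarrow> i < N \<Longrightarrow> x ! i < s"
  unfolding words_def using nth_mem by fastforce

section \<open>Concentration of the Hamming distance to a set of words\<close>

lemma words_Suc: "words s (Suc N) = (\<lambda>(a, x). a # x) ` ({..<s} \<times> words s N)"
  by (auto simp: words_def length_Suc_conv image_iff)

lemma sum_words_Suc:
  "(\<Sum>x\<in>words s (Suc N). f x) = (\<Sum>a<s. \<Sum>x\<in>words s N. f (a # x))"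
  unfolding words_Suc
  by (subst sum.reindex) (auto simp: inj_on_def sum.cartesian_product case_prod_unfold)

lemma hamming_Cons: "hamming (a # x) (b # y) = (if a = b then 0 else 1) + hamming x y"
proof -
  have "{i. i < length (a # x) \<and> (a # x) ! i \<noteq> (b # y) ! i}
      = (if a = b then {} else {0}) \<union> Suc ` {i. i < length x \<and> x ! i \<noteq> y ! i}"
    by (auto simp: image_iff less_Suc_eq_0_disj)
  then show ?thesis
    unfolding hamming_def by (auto simp: card_insert_if card_image)
qed

(* The induction behind Talagrand's concentration inequality for product measures. The function d
   stands for the Hamming distance to A; only that it is at least this distance matters. *)
lemma exponential_moment_distance:
  fixes l :: real
  assumes "1 \<le> l" "A \<subseteq> words s N" "A \<noteq> {}"
  shows "\<exists>d. (\<forall>x\<in>words s N. \<exists>a\<in>A. hamming x a \<le> d x) \<and>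
    (\<Sum>x\<in>words s N. l ^ d x) * card A \<le> ((1 + l)\<^sup>2 / (4 * l)) ^ N * (real s ^ N)\<^sup>2"
  using assms(2,3)
proof (induction N arbitrary: A)
  case 0
  then have "A = {[]}" by (auto simp: words_def)
  then show ?case by (intro exI[of _ "\<lambda>_. 0"]) (auto simp: words_def hamming_def cong: conj_cong)
next
  case (Suc N)
  \<comment> \<open>\<open>K * s^2\<close> is the maximum of
    \<open>(s * (1 + l) - l * y) * y\<close> over real y; this quadratic bounds the growth caused by
    one more letter.\<close>
  define K where "K = (1 + l)\<^sup>2 / (4 * l)"
  define C where "C = K ^ N * (real s ^ N)\<^sup>2"
  have "0 \<le> K" using \<open>1 \<le> l\<close> by (simp add: K_def)
  then have "0 \<le> C" by (simp add: C_def)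
  define sl where "sl a = {x. a # x \<in> A}" for a
  have Cons_in_words: "a # x \<in> words s (Suc N) \<longleftrightarrow> a < s \<and> x \<in> words s N" for a x
    by (auto simp: words_def)
  have sl_sub: "sl a \<subseteq> words s N" for a
    unfolding sl_def using Suc.prems(1) Cons_in_words by blast
  have fin: "finite (sl a)" for a
    by (rule finite_subset[OF sl_sub finite_words])
  have A_eq: "A = (\<Union>a<s. (#) a ` sl a)"
  proof (intro equalityI subsetI)
    fix x assume "x \<in> A"
    then obtain a x' where "x = a # x'" "a < s"
      using Suc.prems(1) by (auto simp: words_Suc dest!: subsetD)
    then show "x \<in> (\<Union>a<s. (#) a ` sl a)" using \<open>x \<in> A\<close> by (auto simp: sl_def)
  qed (auto simp: sl_def)
  have card_A: "card A = (\<Sum>a<s. card (sl a))"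
    unfolding A_eq by (subst card_UN_disjoint) (auto simp: fin card_image)
  have "{..<s} \<noteq> {}" using Suc.prems(2) A_eq by auto
  \<comment> \<open>Let \<open>m\<close> be a first letter with the largest slice of
    \<open>A\<close>. Moving to \<open>m\<close> costs one unit of distance but leaves the largest
    target.\<close>
  then have "Max ((\<lambda>a. card (sl a)) ` {..<s}) \<in> (\<lambda>a. card (sl a)) ` {..<s}"
    by (intro Max_in) auto
  then obtain m where "m < s" and Max_eq: "Max ((\<lambda>a. card (sl a)) ` {..<s}) = card (sl m)"
    by blast
  have m: "card (sl a) \<le> card (sl m)" if "a < s" for a
    unfolding Max_eq[symmetric] using that by (intro Max_ge) auto
  define p where "p = real (card (sl m))"
  have "card A \<noteq> 0"
    using finite_subset[OF Suc.prems(1) finite_words] Suc.prems(2) by simp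
  then obtain a where "a < s" "card (sl a) \<noteq> 0"
    unfolding card_A by (metis lessThan_iff sum.neutral)
  then have "0 < card (sl m)" using m[of a] by linarith
  then have "0 < p" and "sl m \<noteq> {}" by (auto simp: p_def)
  define q where "q a = card (sl a) / p" for a
  have q: "0 \<le> q a" "q a \<le> 1" if "a < s" for a
    using m[OF that] \<open>0 < p\<close> by (auto simp: q_def p_def)
  \<comment> \<open>A word starting with a heads for its own slice if that slice is dense, and for
    slice \<open>m\<close> at the price of a factor l otherwise. Both costs lie below the same
    function, linear in \<open>q a\<close>, so summing over a leaves only
    \<open>card A\<close>.\<close>
  have "\<exists>e. (\<forall>x\<in>words s N. \<exists>w\<in>A. hamming (a # x) w \<le> e x) \<and>
      (\<Sum>x\<in>words s N. l ^ e x) * p \<le> C * (1 + l - l * q a)" if a: "a < s" for a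
  proof (cases "1 \<le> l * q a")
    case True
    then have "0 < q a" using q(1)[OF a] by (cases "q a = 0") auto
    then have "sl a \<noteq> {}" by (auto simp: q_def)
    then obtain d where d: "\<forall>x\<in>words s N. \<exists>y\<in>sl a. hamming x y \<le> d x"
      and sum: "(\<Sum>x\<in>words s N. l ^ d x) * card (sl a) \<le> C"
      using Suc.IH[OF sl_sub] unfolding C_def K_def by blast
    (* The convex function 1/q lies below its chord over [1/l, 1]. *)
    have "0 \<le> (1 - q a) * (l * q a - 1)" using q(2)[OF a] True by simp
    then have chord: "1 \<le> q a * (1 + l - l * q a)" by (simp add: algebra_simps)
    have "(\<Sum>x\<in>words s N. l ^ d x) * p * q a \<le> C * 1"
      using sum \<open>0 < p\<close> by (simp add: q_def mult.assoc)
    also have "\<dots> \<le> C * (q a * (1 + l - l * q a))"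
      using chord \<open>0 \<le> C\<close> by (intro mult_left_mono)
    finally have "(\<Sum>x\<in>words s N. l ^ d x) * p \<le> C * (1 + l - l * q a)"
      using \<open>0 < q a\<close> by (simp add: mult.commute mult.left_commute)
    moreover have "\<exists>w\<in>A. hamming (a # x) w \<le> d x" if "x \<in> words s N" for x
      using d that by (force simp: sl_def hamming_Cons)
    ultimately show ?thesis by blast
  next
    case False
    obtain d where d: "\<forall>x\<in>words s N. \<exists>y\<in>sl m. hamming x y \<le> d x"
      and sum: "(\<Sum>x\<in>words s N. l ^ d x) * card (sl m) \<le> C"
      using Suc.IH[OF sl_sub \<open>sl m \<noteq> {}\<close>] unfolding C_def K_def by blast
    have "(\<Sum>x\<in>words s N. l ^ (d x + 1)) * p = l * ((\<Sum>x\<in>words s N. l ^ d x) * p)"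
      by (simp add: sum_distrib_left sum_distrib_right mult.assoc)
    also have "\<dots> \<le> l * C" using sum \<open>1 \<le> l\<close> by (simp add: p_def)
    also have "\<dots> \<le> C * (1 + l - l * q a)"
      using False mult_left_mono[of l "1 + l - l * q a" C] \<open>0 \<le> C\<close> by (simp add: mult.commute)
    finally have "(\<Sum>x\<in>words s N. l ^ (d x + 1)) * p \<le> C * (1 + l - l * q a)" .
    moreover have "\<exists>w\<in>A. hamming (a # x) w \<le> d x + 1" if x: "x \<in> words s N" for x
    proof -
      obtain y where "y \<in> sl m" "hamming x y \<le> d x" using d x by blast
      then show ?thesis by (intro bexI[of _ "m # y"]) (auto simp: sl_def hamming_Cons)
    qed
    ultimately show ?thesis by (intro exI[of _ "\<lambda>x. d x + 1"]) blast
  qed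
  then obtain e where e: "\<And>a x. a < s \<Longrightarrow> x \<in> words s N \<Longrightarrow> \<exists>w\<in>A. hamming (a # x) w \<le> e a x"
    and sum: "\<And>a. a < s \<Longrightarrow> (\<Sum>x\<in>words s N. l ^ e a x) * p \<le> C * (1 + l - l * q a)"
    by metis
  define d where "d x = e (hd x) (tl x)" for x
  define y where "y = card A / p"
  have sum_q: "(\<Sum>a<s. q a) = y"
    by (simp add: q_def y_def card_A sum_divide_distrib)
  have "(\<Sum>x\<in>words s (Suc N). l ^ d x) * p = (\<Sum>a<s. (\<Sum>x\<in>words s N. l ^ e a x) * p)"
    by (simp add: sum_words_Suc d_def sum_distrib_right)
  also have "\<dots> \<le> (\<Sum>a<s. C * (1 + l - l * q a))" using sum by (intro sum_mono) auto
  also have "\<dots> = C * (s * (1 + l) - l * y)"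
    by (simp add: sum_q[symmetric] sum_subtractf sum.distrib flip: sum_distrib_left)
  finally have "(\<Sum>x\<in>words s (Suc N). l ^ d x) * p * y \<le> C * (s * (1 + l) - l * y) * y"
    using \<open>0 < p\<close> by (intro mult_right_mono) (auto simp: y_def)
  also have "\<dots> \<le> C * (K * (real s)\<^sup>2)"
  proof -
    \<comment> \<open>Completing the square gives the maximum of the quadratic in y.\<close>
    have "0 \<le> (s * (1 + l) - 2 * l * y)\<^sup>2" by simp
    then have "4 * l * ((s * (1 + l) - l * y) * y) \<le> (1 + l)\<^sup>2 * (real s)\<^sup>2"
      by (simp add: power2_eq_square algebra_simps)
    then have "(s * (1 + l) - l * y) * y \<le> K * (real s)\<^sup>2"
      using \<open>1 \<le> l\<close> by (simp add: K_def field_simps)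
    then show ?thesis using \<open>0 \<le> C\<close> by (simp add: mult_left_mono mult.assoc)
  qed
  finally have "(\<Sum>x\<in>words s (Suc N). l ^ d x) * card A \<le> K ^ Suc N * (real s ^ Suc N)\<^sup>2"
    using \<open>0 < p\<close> by (simp add: y_def C_def power_mult_distrib mult_ac)
  moreover have "\<forall>x\<in>words s (Suc N). \<exists>w\<in>A. hamming x w \<le> d x"
    using e by (auto simp: words_Suc d_def)
  ultimately show ?case unfolding K_def by blast
qed

text \<open>At \<open>\<mu> = 1\<close> both sides equal 1, but there the left side has derivative 0
  and the right side derivative 1, so the inequality holds just to the right of 1. After clearing
  denominators the difference \<open>?g\<close> has derivative
  \<open>4 * (k + 1) - 4 * k = 4\<close> at 1.\<close>

lemma ex_base_gt_1:
  fixes k :: nat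
  shows "\<exists>\<mu>::real. 1 < \<mu> \<and> (1 + \<mu> ^ k)\<^sup>2 / (4 * \<mu> ^ k) < \<mu>"
proof -
  let ?g = "\<lambda>x::real. 4 * x ^ (k + 1) - (1 + x ^ k)\<^sup>2"
  have "DERIV ?g 1 :> 4"
    by (auto intro!: derivative_eq_intros)
  from DERIV_pos_inc_right[OF this] obtain h where "0 < h"
    and inc: "\<And>t. 0 < t \<Longrightarrow> t < h \<Longrightarrow> ?g 1 < ?g (1 + t)"
    by auto
  have "?g 1 < ?g (1 + h / 2)" by (rule inc) (use \<open>0 < h\<close> in auto)
  then have "0 < ?g (1 + h / 2)" by simp
  with \<open>0 < h\<close> show ?thesis
    by (intro exI[of _ "1 + h / 2"]) (simp add: pos_divide_less_eq mult_ac)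
qed

section \<open>Cliques among words with few agreements\<close>

text \<open>The threshold 2N/(s(s+1)) is the number of positions divided by the number of pairs
  among s + 1 words; it is written without division.\<close>

definition hamming_edges :: "nat \<Rightarrow> nat \<Rightarrow> nat list set set" where
  "hamming_edges s N =
     {{x, y} | x y. x \<in> words s N \<and> y \<in> words s N \<and> s * (s + 1) * agree x y < 2 * N}"

lemma agree_commute: "length x = length y \<Longrightarrow> agree x y = agree y x"
  unfolding agree_def by (rule arg_cong[of _ _ card]) auto

lemma hamming_edges_iff:
  assumes "x \<in> words s N" "y \<in> words s N"
  shows "{x, y} \<in> hamming_edges s N \<longleftrightarrow> s * (s + 1) * agree x y < 2 * N"
proof -
  have "agree x y = agree y x" by (rule agree_commute) (simp add: length_words[OF assms(1)] length_words[OF assms(2)])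
  then show ?thesis using assms unfolding hamming_edges_def mem_Collect_eq doubleton_eq_iff by metis
qed

(* Among s + 1 words every position carries a repeated letter, so some pair agrees often. *)
lemma hamming_edges_no_clique:
  assumes "0 < s"
  shows "\<not> has_clique (s + 1) (hamming_edges s N) (words s N)"
proof
  assume "has_clique (s + 1) (hamming_edges s N) (words s N)"
  then obtain S where S: "S \<subseteq> words s N" "finite S" "card S = s + 1"
    and adj: "pairwise_adjacent (hamming_edges s N) S"
    unfolding has_clique_def by blast
  \<comment> \<open>The pairs are ordered, so there are s(s+1) of them and each position has at
    least two agreeing ones. The agreements are then counted both by positions and by pairs.\<close>
  define P where "P = {(x, y). x \<in> S \<and> y \<in> S \<and> x \<noteq> y}"
  have P_eq: "P = S \<times> S - (\<lambda>x. (x, x)) ` S" by (auto simp: P_def)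
  then have "card P = card (S \<times> S) - card ((\<lambda>x. (x, x)) ` S)"
    using S(2) by (simp add: card_Diff_subset image_subset_iff)
  then have card_P: "card P = s * (s + 1)" and "finite P"
    using S P_eq by (auto simp: card_image inj_on_def card_cartesian_product)
  have two: "2 \<le> card {xy \<in> P. fst xy ! i = snd xy ! i}" if "i < N" for i
  proof -
    have "(\<lambda>x. x ! i) ` S \<subseteq> {..<s}" using S(1) nth_words \<open>i < N\<close> by blast
    then have "card ((\<lambda>x. x ! i) ` S) \<le> s" by (metis card_lessThan card_mono finite_lessThan)
    then have "\<not> inj_on (\<lambda>x. x ! i) S" using S(3) card_image[of "\<lambda>x. x ! i" S] by auto
    then obtain x y where xy: "x \<in> S" "y \<in> S" "x \<noteq> y" "x ! i = y ! i" by (auto simp: inj_on_def)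
    then have "card {(x, y), (y, x)} \<le> card {xy \<in> P. fst xy ! i = snd xy ! i}"
      using \<open>finite P\<close> by (intro card_mono) (auto simp: P_def)
    then show ?thesis using xy(3) by simp
  qed
  have agree_sum: "agree x y = (\<Sum>i<N. if x ! i = y ! i then 1 else 0)" if "(x, y) \<in> P" for x y
  proof -
    have "length x = N" using that S(1) by (auto simp: P_def words_def)
    then have "{i. i < length x \<and> x ! i = y ! i} = {..<N} \<inter> {i. x ! i = y ! i}" by auto
    then show ?thesis by (simp add: agree_def sum.If_cases)
  qed
  have "2 * N = (\<Sum>i<N. 2)" by simp
  also have "\<dots> \<le> (\<Sum>i<N. card {xy \<in> P. fst xy ! i = snd xy ! i})"
    by (intro sum_mono two) simp
  also have "\<dots> = (\<Sum>i<N. \<Sum>xy\<in>P. if fst xy ! i = snd xy ! i then 1 else 0)"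
    using \<open>finite P\<close> by (intro sum.cong) (auto simp: sum.If_cases Int_def)
  also have "\<dots> = (\<Sum>xy\<in>P. agree (fst xy) (snd xy))"
    by (subst sum.swap) (auto intro!: sum.cong simp: agree_sum)
  finally have le: "2 * N \<le> (\<Sum>xy\<in>P. agree (fst xy) (snd xy))" .
  have lt: "s * (s + 1) * agree (fst xy) (snd xy) < 2 * N" if P: "xy \<in> P" for xy
  proof -
    obtain x y where xy: "xy = (x, y)" "x \<in> S" "y \<in> S" "x \<noteq> y" using P by (auto simp: P_def)
    then have "{x, y} \<in> hamming_edges s N" using adj by (simp add: pairwise_adjacent_def)
    moreover have "x \<in> words s N" "y \<in> words s N" using xy S(1) by auto
    ultimately show ?thesis using xy(1) hamming_edges_iff by simp
  qed
  have "card P \<noteq> 0" using assms card_P by simp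
  then have "P \<noteq> {}" by auto
  have "s * (s + 1) * (2 * N) \<le> s * (s + 1) * (\<Sum>xy\<in>P. agree (fst xy) (snd xy))"
    using le by (rule mult_le_mono2)
  also have "\<dots> = (\<Sum>xy\<in>P. s * (s + 1) * agree (fst xy) (snd xy))" by (rule sum_distrib_left)
  also have "\<dots> < (\<Sum>xy\<in>P. 2 * N)"
    using \<open>finite P\<close> \<open>P \<noteq> {}\<close> lt by (rule sum_strict_mono)
  finally show False using card_P by simp
qed

text \<open>Where x and y agree, x must deviate from u or y from v, since u and v differ there.
  Hence words close to two everywhere different words have few agreements.\<close>

lemma agree_le_hamming:
  assumes "length x = N" "length u = N" "length v = N" "length y = N"
    and "\<And>i. i < N \<Longrightarrow> u ! i \<noteq> v ! i"
  shows "agree x y \<le> hamming u x + hamming v y"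
proof -
  have "agree x y \<le> card ({i. i < N \<and> u ! i \<noteq> x ! i} \<union> {i. i < N \<and> v ! i \<noteq> y ! i})"
  proof -
    have "u ! i \<noteq> x ! i \<or> v ! i \<noteq> y ! i" if "i < N" "x ! i = y ! i" for i
      using assms(5)[OF that(1)] that(2) by metis
    then show ?thesis unfolding agree_def using assms(1) by (intro card_mono) auto
  qed
  also have "\<dots> \<le> hamming u x + hamming v y"
    unfolding hamming_def using assms(2,3) by (simp add: card_Un_le)
  finally show ?thesis .
qed

definition shift :: "nat \<Rightarrow> nat \<Rightarrow> nat list \<Rightarrow> nat list" where
  "shift s j = map (\<lambda>a. (a + j) mod s)"

lemma shift_in_words: "0 < s \<Longrightarrow> x \<in> words s N \<Longrightarrow> shift s j x \<in> words s N"
  by (auto simp: words_def shift_def)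

text \<open>It serves twice: it makes a fixed shift injective, and with letter and shift exchanged
  it makes distinct shifts of a word differ in every position.\<close>

lemma mod_add_inj:
  fixes a b j :: nat
  assumes "a < s" "b < s" "(a + j) mod s = (b + j) mod s"
  shows "a = b"
proof -
  obtain q r where "a + j + s * q = b + j + s * r"
    using assms(3) nat_mod_eq_iff by blast
  then have "a + s * q = b + s * r" by linarith
  then have "(a + s * q) mod s = (b + s * r) mod s" by (rule arg_cong)
  then show ?thesis using assms(1,2) by simp
qed

lemma inj_on_shift: "inj_on (shift s j) (words s N)"
proof (rule inj_onI)
  fix x y assume xy: "x \<in> words s N" "y \<in> words s N" and eq: "shift s j x = shift s j y"
  show "x = y"
  proof (rule nth_equalityI)
    fix i assume "i < length x"
    then have i: "i < N" "i < length y" using xy by (auto simp: words_def)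
    have "(x ! i + j) mod s = (y ! i + j) mod s"
      using arg_cong[OF eq, of "\<lambda>w. w ! i"] i(2) \<open>i < length x\<close> by (simp add: shift_def)
    then show "x ! i = y ! i" by (rule mod_add_inj[OF nth_words[OF xy(1) i(1)] nth_words[OF xy(2) i(1)]])
  qed (simp add: length_words[OF xy(1)] length_words[OF xy(2)])
qed

(* The s cyclic shifts of a word pairwise disagree everywhere. If fewer than 1/s of all words are far
   from A, then some word has all its shifts near A, and nearby words of A form a clique. *)
lemma hamming_clique_if_few_far:
  assumes "2 \<le> s" "0 < N" "A \<subseteq> words s N" "B \<subseteq> words s N" "s * card B < s ^ N"
    and near: "\<And>x. x \<in> words s N - B \<Longrightarrow> \<exists>a\<in>A. 2 * s * (s + 1) * hamming x a \<le> N"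
  shows "has_clique s (hamming_edges s N) A"
proof -
  define Q where "Q j = {x \<in> words s N. shift s j x \<in> B}" for j
  have fB: "finite B" by (rule finite_subset[OF assms(4) finite_words])
  have "card (Q j) \<le> card B" for j
    using fB inj_on_shift[of s j N] by (intro card_inj_on_le[of "shift s j"]) (auto simp: Q_def inj_on_def)
  \<comment> \<open>Union bound: the words having some shift in \<open>B\<close> do not exhaust all
    words.\<close>
  then have "(\<Sum>j<s. card (Q j)) \<le> s * card B"
    using sum_mono[of "{..<s}" "\<lambda>j. card (Q j)" "\<lambda>_. card B"] by simp
  then have "card (\<Union>j<s. Q j) < card (words s N)"
    using card_UN_le[of "{..<s}" Q] assms(5) by (simp add: card_words)
  then have "\<not> words s N \<subseteq> (\<Union>j<s. Q j)"
    using card_mono[of "\<Union>j<s. Q j" "words s N"] by (auto simp: Q_def)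
  then obtain x where x: "x \<in> words s N" "\<And>j. j < s \<Longrightarrow> shift s j x \<notin> B"
    by (auto simp: Q_def)
  have "\<exists>a\<in>A. 2 * s * (s + 1) * hamming (shift s j x) a \<le> N" if "j < s" for j
    using that x \<open>2 \<le> s\<close> by (intro near) (auto simp: shift_in_words)
  then obtain w where w: "\<And>j. j < s \<Longrightarrow> w j \<in> A"
    "\<And>j. j < s \<Longrightarrow> 2 * s * (s + 1) * hamming (shift s j x) (w j) \<le> N" by metis
  have wW: "w j \<in> words s N" if "j < s" for j using w(1)[OF that] assms(3) by blast
  \<comment> \<open>Each \<open>w j\<close> is within N/(2s(s+1)) of its shift, so two of them agree
    in at most N/(s(s+1)) positions, half of the threshold; \<open>0 < N\<close> makes this
    strict.\<close>
  have few: "s * (s + 1) * agree (w j) (w k) < 2 * N" if jk: "j < s" "k < s" "j \<noteq> k" for j k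
  proof -
    have "agree (w j) (w k) \<le> hamming (shift s j x) (w j) + hamming (shift s k x) (w k)"
    proof (rule agree_le_hamming)
      fix i assume "i < N"
      then show "shift s j x ! i \<noteq> shift s k x ! i"
        using jk x(1) mod_add_inj[of j s k "x ! i"] by (auto simp: shift_def length_words add.commute)
    qed (use jk x(1) length_words[OF wW] in \<open>auto simp: length_words shift_def\<close>)
    then have "2 * s * (s + 1) * agree (w j) (w k)
        \<le> 2 * s * (s + 1) * (hamming (shift s j x) (w j) + hamming (shift s k x) (w k))"
      by (rule mult_le_mono2)
    also have "\<dots> \<le> N + N" using add_mono[OF w(2)[OF jk(1)] w(2)[OF jk(2)]] by (simp only: distrib_left)
    finally have "2 * (s * (s + 1) * agree (w j) (w k)) \<le> N + N" by (simp only: mult.assoc)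
    then show ?thesis using \<open>0 < N\<close> by linarith
  qed
  \<comment> \<open>Equal words would agree in all N positions, which \<open>few\<close>
    excludes.\<close>
  have inj: "inj_on w {..<s}"
  proof (rule inj_onI, rule ccontr)
    fix j k assume jk: "j \<in> {..<s}" "k \<in> {..<s}" "w j = w k" "j \<noteq> k"
    have "agree (w j) (w j) = N" using wW[of j] jk by (simp add: agree_def length_words)
    then have "s * (s + 1) * N < 2 * N" using few[of j k] jk by auto
    moreover have "2 * 1 \<le> s * (s + 1)" using \<open>2 \<le> s\<close> by (intro mult_le_mono) auto
    ultimately show False using mult_le_mono1[of 2 "s * (s + 1)" N] by simp
  qed
  have "pairwise_adjacent (hamming_edges s N) (w ` {..<s})"
    unfolding pairwise_adjacent_def using few wW by (auto simp: hamming_edges_iff)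
  then show ?thesis
    using card_image[OF inj] w(1) unfolding has_clique_def by (intro exI[of _ "w ` {..<s}"]) auto
qed

text \<open>For N > 0 and nonempty \<open>A\<close> without a clique, at least a fraction 1/s of all
  words have \<open>d x > N / k\<close>. With base \<open>l = \<mu> ^ k\<close> each of them
  contributes at least \<open>\<mu> ^ N\<close> to the exponential moment, which is bounded through
  \<open>K ^ N\<close>. This yields \<open>\<rho> = K / \<mu>\<close>, below 1 by the choice of
  \<open>\<mu>\<close>.\<close>

lemma card_le_if_no_hamming_clique:
  assumes "2 \<le> s"
  shows "\<exists>\<rho>::real. 0 < \<rho> \<and> \<rho> < 1 \<and> (\<forall>N A. A \<subseteq> words s N \<longrightarrow>
    \<not> has_clique s (hamming_edges s N) A \<longrightarrow> card A \<le> s * \<rho> ^ N * real s ^ N)"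
proof -
  \<comment> \<open>N/k is exactly the distance up to which words count as near in
    \<open>hamming_clique_if_few_far\<close>.\<close>
  define k where "k = 2 * s * (s + 1)"
  obtain \<mu> :: real where \<mu>: "1 < \<mu>" "(1 + \<mu> ^ k)\<^sup>2 / (4 * \<mu> ^ k) < \<mu>"
    using ex_base_gt_1 by blast
  define K where "K = (1 + \<mu> ^ k)\<^sup>2 / (4 * \<mu> ^ k)"
  have "0 < 1 + \<mu> ^ k" using \<mu>(1) by (simp add: add_pos_pos)
  then have "0 < K" using \<mu>(1) by (simp add: K_def)
  have "card A \<le> s * (K / \<mu>) ^ N * real s ^ N"
    if A: "A \<subseteq> words s N" "\<not> has_clique s (hamming_edges s N) A" for N A
  proof (cases "N = 0 \<or> A = {}")
    case True
    moreover have "card A \<le> s" if "N = 0"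
      using A(1) that card_mono[OF finite_words A(1)] \<open>2 \<le> s\<close> by (simp add: card_words)
    ultimately show ?thesis using \<open>0 < K\<close> \<mu>(1) by auto
  next
    case False
    then have "A \<noteq> {}" by simp
    have "1 \<le> \<mu> ^ k" using \<mu>(1) by (simp add: one_le_power)
    from exponential_moment_distance[OF this A(1) \<open>A \<noteq> {}\<close>, folded K_def]
    obtain d where d: "\<forall>x\<in>words s N. \<exists>a\<in>A. hamming x a \<le> d x"
      and sum: "(\<Sum>x\<in>words s N. (\<mu> ^ k) ^ d x) * card A \<le> K ^ N * (real s ^ N)\<^sup>2"
      by blast
    define B where "B = {x \<in> words s N. N < k * d x}"
    have "s ^ N \<le> s * card B"
    proof (rule ccontr)
      assume less: "\<not> ?thesis"
      have "has_clique s (hamming_edges s N) A"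
      proof (rule hamming_clique_if_few_far[of s N A B])
        fix x assume "x \<in> words s N - B"
        then have x: "x \<in> words s N" "k * d x \<le> N" by (simp_all add: B_def not_less)
        then obtain a where "a \<in> A" "hamming x a \<le> d x" using d by blast
        from this(2) have "k * hamming x a \<le> k * d x" by (rule mult_le_mono2)
        also note x(2)
        finally show "\<exists>a\<in>A. 2 * s * (s + 1) * hamming x a \<le> N"
          using \<open>a \<in> A\<close> unfolding k_def by (rule bexI)
      next
        show "s * card B < s ^ N" using less by simp
      qed (use assms A(1) False in \<open>auto simp: B_def\<close>)
      then show False using A(2) by blast
    qed
    then have "real (s ^ N) \<le> real (s * card B)" by (rule of_nat_mono)
    then have B: "real s ^ N \<le> s * card B" by simp
    have "card B * \<mu> ^ N = (\<Sum>x\<in>B. \<mu> ^ N)" by simp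
    also have "\<dots> \<le> (\<Sum>x\<in>B. (\<mu> ^ k) ^ d x)"
    proof (rule sum_mono)
      fix x assume "x \<in> B"
      then have "\<mu> ^ N \<le> \<mu> ^ (k * d x)"
        using \<mu>(1) by (intro power_increasing) (simp_all add: B_def)
      then show "\<mu> ^ N \<le> (\<mu> ^ k) ^ d x" by (simp only: power_mult)
    qed
    also have "\<dots> \<le> (\<Sum>x\<in>words s N. (\<mu> ^ k) ^ d x)"
      using \<mu>(1) by (intro sum_mono2) (auto simp: B_def)
    finally have "card B * \<mu> ^ N * card A \<le> (\<Sum>x\<in>words s N. (\<mu> ^ k) ^ d x) * card A"
      by (rule mult_right_mono) simp
    also note sum
    finally have "card B * \<mu> ^ N * card A \<le> K ^ N * (real s ^ N)\<^sup>2" .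
    then have "s * (card B * \<mu> ^ N * card A) \<le> s * (K ^ N * (real s ^ N)\<^sup>2)"
      by (intro mult_left_mono) auto
    moreover have "real s ^ N * (\<mu> ^ N * card A) \<le> s * card B * (\<mu> ^ N * card A)"
      using B \<mu>(1) by (intro mult_right_mono) auto
    ultimately have "real s ^ N * (\<mu> ^ N * card A) \<le> real s ^ N * (s * K ^ N * real s ^ N)"
      by (simp add: power2_eq_square mult_ac)
    then have "\<mu> ^ N * card A \<le> s * K ^ N * real s ^ N" using \<open>2 \<le> s\<close> by simp
    then have "card A \<le> s * K ^ N * real s ^ N / \<mu> ^ N"
      using \<mu>(1) by (simp add: pos_le_divide_eq mult.commute)
    then show ?thesis by (simp add: power_divide)
  qed
  moreover have "K < \<mu>" using \<mu>(2) unfolding K_def .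
  ultimately show ?thesis
    using \<mu>(1) \<open>0 < K\<close> by (intro exI[of _ "K / \<mu>"]) simp
qed

text \<open>Any m of the s^N words span a \<open>K_{s+1}\<close>-free graph whose
  \<open>K_s\<close>-free sets are exponentially sparse among all words. When s^N is of order m,
  this is a saving of a power of m.\<close>

lemma erdos_rogers_exponential_saving:
  assumes "2 \<le> s"
  shows "\<exists>\<rho>::real. 0 < \<rho> \<and> \<rho> < 1 \<and>
    (\<forall>N m. m \<le> s ^ N \<longrightarrow> erdos_rogers s (s + 1) m \<le> s * \<rho> ^ N * real s ^ N)"
proof -
  obtain \<rho> :: real where \<rho>: "0 < \<rho>" "\<rho> < 1"
    and small: "\<And>N A. A \<subseteq> words s N \<Longrightarrow> \<not> has_clique s (hamming_edges s N) A \<Longrightarrow>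
      card A \<le> s * \<rho> ^ N * real s ^ N"
    using card_le_if_no_hamming_clique[OF assms] by blast
  have "erdos_rogers s (s + 1) m \<le> s * \<rho> ^ N * real s ^ N" if "m \<le> s ^ N" for N m
  proof -
    from that have "m \<le> card (words s N)" by (simp only: card_words)
    then obtain U where U: "U \<subseteq> words s N" "card U = m" "finite U"
      by (rule obtain_subset_with_card_n)
    have "erdos_rogers s (s + 1) m \<le> nat \<lfloor>s * \<rho> ^ N * real s ^ N\<rfloor>"
    proof (rule erdos_rogers_le[OF U(3,2)])
      show "\<not> has_clique (s + 1) (hamming_edges s N) U"
      proof
        assume "has_clique (s + 1) (hamming_edges s N) U"
        then have "has_clique (s + 1) (hamming_edges s N) (words s N)"
          using U(1) by (rule has_clique_mono)
        moreover have "0 < s" using assms by simp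
        ultimately show False by (metis hamming_edges_no_clique)
      qed
      show "card W \<le> nat \<lfloor>s * \<rho> ^ N * real s ^ N\<rfloor>"
        if "W \<subseteq> U" "\<not> has_clique s (hamming_edges s N) W" for W
        by (rule le_nat_floor, rule small[OF order_trans[OF that(1) U(1)] that(2)])
    qed (use assms in simp)
    then have "real (erdos_rogers s (s + 1) m) \<le> real (nat \<lfloor>s * \<rho> ^ N * real s ^ N\<rfloor>)"
      by (rule of_nat_mono)
    also have "\<dots> \<le> s * \<rho> ^ N * real s ^ N" using \<rho>(1) by (intro of_nat_floor) simp
    finally show ?thesis .
  qed
  then show ?thesis using \<rho> by (intro exI[of _ \<rho>] conjI allI impI)
qed


section \<open>Dependent random choice\<close>

definition neighbours :: "'a graph \<Rightarrow> 'a \<Rightarrow> 'a set" where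
  "neighbours G v = {u \<in> verts G. {u, v} \<in> edges G}"

definition common_neighbours :: "'a graph \<Rightarrow> 'a set \<Rightarrow> 'a set" where
  "common_neighbours G S = {u \<in> verts G. \<forall>v\<in>S. {u, v} \<in> edges G}"

lemma card_edges_le_sum_degrees:
  assumes "finite (verts G)" "edges G \<subseteq> nsets (verts G) 2"
  shows "card (edges G) \<le> (\<Sum>v\<in>verts G. card (neighbours G v))"
proof -
  let ?P = "SIGMA v:verts G. neighbours G v"
  have fin: "finite ?P" using assms(1) by (auto simp: neighbours_def)
  have "edges G \<subseteq> (\<lambda>(v, u). {u, v}) ` ?P"
  proof
    fix e assume e: "e \<in> edges G"
    then obtain u v where "e = {u, v}" "u \<in> verts G" "v \<in> verts G"
      using assms(2) by (force simp: nsets_def card_2_iff)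
    then show "e \<in> (\<lambda>(v, u). {u, v}) ` ?P" using e by (force simp: neighbours_def)
  qed
  then have "card (edges G) \<le> card ?P" using surj_card_le[OF fin] by blast
  also have "\<dots> = (\<Sum>v\<in>verts G. card (neighbours G v))"
    using assms(1) by (auto simp: neighbours_def)
  finally show ?thesis .
qed

text \<open>The average degree is at least 2dn, so at least dn vertices have degree at least dn;
  these alone contribute \<open>(d * n) ^ (t + 1)\<close>.\<close>

lemma sum_degree_power_ge:
  fixes d :: real
  assumes V: "finite (verts G)" "card (verts G) = n" and "0 < n" "0 \<le> d"
    and many: "2 * d * (real n)\<^sup>2 \<le> (\<Sum>v\<in>verts G. card (neighbours G v))"
  shows "d ^ (t + 1) * real n ^ (t + 1) \<le> (\<Sum>v\<in>verts G. real (card (neighbours G v)) ^ t)"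
proof -
  define H where "H = {v \<in> verts G. d * n \<le> card (neighbours G v)}"
  have H: "H \<subseteq> verts G" "finite H" using V(1) by (auto simp: H_def)
  have deg: "card (neighbours G v) \<le> n" for v
    using V card_mono[of "verts G" "neighbours G v"] by (auto simp: neighbours_def)
  have "(\<Sum>v\<in>verts G. real (card (neighbours G v)))
      \<le> (\<Sum>v\<in>verts G. (if v \<in> H then real n else 0) + d * n)"
    using deg \<open>0 \<le> d\<close> by (intro sum_mono) (auto simp: H_def add_increasing2)
  also have "\<dots> = card H * n + d * n * n"
    using V H by (simp add: sum.distrib sum.If_cases Int_absorb1)
  finally have "2 * d * (real n)\<^sup>2 \<le> card H * n + d * n * n" using many by simp
  then have "d * n * n \<le> card H * n" by (simp add: power2_eq_square)
  then have card_H: "d * n \<le> card H" using \<open>0 < n\<close> by simp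
  have "d ^ (t + 1) * real n ^ (t + 1) = d * n * (d * n) ^ t" by (simp add: power_mult_distrib)
  also have "\<dots> \<le> card H * (d * n) ^ t"
    using card_H \<open>0 \<le> d\<close> by (intro mult_right_mono) auto
  also have "\<dots> = (\<Sum>v\<in>H. (d * n) ^ t)" by simp
  also have "\<dots> \<le> (\<Sum>v\<in>H. real (card (neighbours G v)) ^ t)"
    using \<open>0 \<le> d\<close> by (intro sum_mono power_mono) (auto simp: H_def)
  also have "\<dots> \<le> (\<Sum>v\<in>verts G. real (card (neighbours G v)) ^ t)"
    using H V by (intro sum_mono2) auto
  finally show ?thesis .
qed

text \<open>Double counting of pairs of a list T and a vertex v adjacent to all its entries. Lists
  model sampling with repetition: for fixed v they are exactly the lists over its
  neighbourhood.\<close>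

lemma sum_common_neighbours:
  assumes "finite (verts G)"
  shows "(\<Sum>T | set T \<subseteq> verts G \<and> length T = t. card (common_neighbours G (set T)))
    = (\<Sum>v\<in>verts G. card (neighbours G v) ^ t)"
proof -
  let ?L = "{T. set T \<subseteq> verts G \<and> length T = t}"
  have fin: "finite ?L" using assms by (rule finite_lists_length_eq)
  have "(\<Sum>T\<in>?L. card (common_neighbours G (set T)))
      = (\<Sum>T\<in>?L. \<Sum>v\<in>verts G. if \<forall>u\<in>set T. {v, u} \<in> edges G then 1 else 0)"
    using assms by (intro sum.cong) (auto simp: common_neighbours_def sum.If_cases Int_def)
  also have "\<dots> = (\<Sum>v\<in>verts G. \<Sum>T\<in>?L. if \<forall>u\<in>set T. {v, u} \<in> edges G then 1 else 0)"
    by (rule sum.swap)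
  also have "\<dots> = (\<Sum>v\<in>verts G. card (neighbours G v) ^ t)"
  proof (rule sum.cong)
    fix v
    have "(\<Sum>T\<in>?L. if \<forall>u\<in>set T. {v, u} \<in> edges G then 1 else 0)
        = card {T \<in> ?L. \<forall>u\<in>set T. {v, u} \<in> edges G}"
      using fin by (simp add: sum.If_cases Int_def)
    also have "{T \<in> ?L. \<forall>u\<in>set T. {v, u} \<in> edges G}
        = {T. set T \<subseteq> neighbours G v \<and> length T = t}"
      by (auto simp: neighbours_def insert_commute)
    also have "card \<dots> = card (neighbours G v) ^ t"
      using assms by (intro card_lists_length_eq) (simp add: neighbours_def)
    finally show "(\<Sum>T\<in>?L. if \<forall>u\<in>set T. {v, u} \<in> edges G then 1 else 0)
        = card (neighbours G v) ^ t" .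
  qed simp
  finally show ?thesis .
qed

text \<open>The random choice appears as counting lists of length t. If every set of at least m
  vertices contains an r-set with at most b common neighbours, then the many lists with large common
  neighbourhoods must fit into few small sets.\<close>

lemma dependent_random_choice:
  fixes d :: real
  assumes V: "finite (verts G)" "card (verts G) = n" and "0 < n" "0 \<le> d"
    and E: "edges G \<subseteq> nsets (verts G) 2" "2 * d * (real n)\<^sup>2 \<le> card (edges G)"
    and m: "real m \<le> d ^ (t + 1) * n / 2"
    and bad: "\<And>U. U \<subseteq> verts G \<Longrightarrow> m \<le> card U \<Longrightarrow>
      \<exists>S\<subseteq>U. card S = r \<and> finite S \<and> card (common_neighbours G S) \<le> b"
  shows "d ^ (t + 1) / 2 * real n ^ t \<le> real n ^ r * real b ^ t"
proof -
  let ?L = "{T. set T \<subseteq> verts G \<and> length T = t}"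
  define X where "X = {T \<in> ?L. m \<le> card (common_neighbours G (set T))}"
  have fin: "finite ?L" using V(1) by (rule finite_lists_length_eq)
  have finN: "finite (common_neighbours G S)" for S
    using V(1) by (simp add: common_neighbours_def)
  have cardN: "card (common_neighbours G S) \<le> n" for S
    using V card_mono[of "verts G" "common_neighbours G S"] by (auto simp: common_neighbours_def)
  have "2 * d * (real n)\<^sup>2 \<le> (\<Sum>v\<in>verts G. card (neighbours G v))"
    using E(2) card_edges_le_sum_degrees[OF V(1) E(1)] by linarith
  then have "d ^ (t + 1) * real n ^ (t + 1) \<le> (\<Sum>v\<in>verts G. real (card (neighbours G v)) ^ t)"
    using assms by (intro sum_degree_power_ge) auto
  also have "\<dots> = (\<Sum>T\<in>?L. real (card (common_neighbours G (set T))))"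
    using arg_cong[OF sum_common_neighbours[OF V(1)], of real t] by simp
  \<comment> \<open>A list in \<open>X\<close> contributes at most n beyond the m granted to every
    list. As m is at most half of \<open>d ^ (t + 1) * n\<close>, the lists in \<open>X\<close> must
    supply the other half.\<close>
  also have "\<dots> \<le> (\<Sum>T\<in>?L. (if T \<in> X then real n else 0) + m)"
    using cardN by (intro sum_mono) (auto simp: X_def intro: add_increasing2)
  also have "\<dots> = card X * n + real n ^ t * m"
    using fin V card_lists_length_eq[OF V(1), of t]
    by (simp add: sum.distrib sum.If_cases X_def Int_def)
  finally have "d ^ (t + 1) * real n ^ (t + 1) \<le> card X * n + real n ^ t * m" .
  also have "\<dots> \<le> card X * n + real n ^ t * (d ^ (t + 1) * n / 2)"
    using m by (intro add_left_mono mult_left_mono) auto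
  finally have "(d ^ (t + 1) / 2 * real n ^ t) * n \<le> card X * n" by (simp add: field_simps)
  then have X_ge: "d ^ (t + 1) / 2 * real n ^ t \<le> card X" using \<open>0 < n\<close> by simp
  define Y where "Y = {S \<in> nsets (verts G) r. card (common_neighbours G S) \<le> b}"
  have finY: "finite Y" using V(1) by (auto simp: Y_def finite_imp_finite_nsets)
  have "card Y \<le> n choose r"
    using V card_mono[of "nsets (verts G) r" Y] by (auto simp: Y_def card_nsets finite_imp_finite_nsets)
  also have "\<dots> \<le> n ^ r" by (cases "r \<le> n") (auto simp: binomial_le_pow binomial_eq_0)
  finally have card_Y: "card Y \<le> n ^ r" .
  \<comment> \<open>If S lies in the common neighbourhood of T, then the entries of T lie in that of
    S, which leaves at most \<open>b ^ t\<close> lists for each bad S.\<close>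
  have "X \<subseteq> (\<Union>S\<in>Y. {T. set T \<subseteq> common_neighbours G S \<and> length T = t})"
  proof
    fix T assume T: "T \<in> X"
    then obtain S where S: "S \<subseteq> common_neighbours G (set T)" "card S = r" "finite S"
      "card (common_neighbours G S) \<le> b"
      using bad[of "common_neighbours G (set T)"] by (auto simp: X_def common_neighbours_def)
    then have "S \<in> Y" by (auto simp: Y_def nsets_def common_neighbours_def)
    moreover have "set T \<subseteq> common_neighbours G S"
    proof
      fix x assume "x \<in> set T"
      then have "{x, v} \<in> edges G" if "v \<in> S" for v
        using S(1) that by (auto simp: common_neighbours_def insert_commute dest!: subsetD)
      moreover have "x \<in> verts G" using \<open>x \<in> set T\<close> T by (auto simp: X_def)
      ultimately show "x \<in> common_neighbours G S" by (simp add: common_neighbours_def)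
    qed
    ultimately show "T \<in> (\<Union>S\<in>Y. {T. set T \<subseteq> common_neighbours G S \<and> length T = t})"
      using T by (auto simp: X_def)
  qed
  then have "card X \<le> card (\<Union>S\<in>Y. {T. set T \<subseteq> common_neighbours G S \<and> length T = t})"
    using finY finN by (intro card_mono) (auto intro: finite_lists_length_eq)
  also have "\<dots> \<le> (\<Sum>S\<in>Y. card {T. set T \<subseteq> common_neighbours G S \<and> length T = t})"
    by (rule card_UN_le[OF finY])
  also have "\<dots> \<le> (\<Sum>S\<in>Y. b ^ t)"
    using finN by (intro sum_mono) (auto simp: card_lists_length_eq Y_def intro: power_mono)
  also have "\<dots> \<le> n ^ r * b ^ t" using card_Y by simp
  finally have "real (card X) \<le> real (n ^ r * b ^ t)" by (rule of_nat_mono)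
  then show ?thesis using X_ge by simp
qed

section \<open>Application to \<open>K_{2s+1}\<close>-free graphs\<close>

text \<open>Take S to be a \<open>K_{s+1}\<close> in \<open>U\<close>. A \<open>K_s\<close> among
  its common neighbours would complete a \<open>K_{2s+1}\<close>, so these form a
  \<open>K_s\<close>-free set, no larger than the independence number.\<close>

lemma few_common_neighbours_if_no_clique:
  assumes G: "G \<in> graphs_on n" "\<not> contains_copy G (complete_graph (2 * s + 1))" "0 < s"
    and less: "s_independence_number s G < erdos_rogers s (s + 1) m"
    and U: "U \<subseteq> verts G" "m \<le> card U"
  shows "\<exists>S\<subseteq>U. card S = s + 1 \<and> finite S \<and> card (common_neighbours G S) \<le> erdos_rogers s (s + 1) m"
proof -
  have fin: "finite (verts G)" using G(1) by (auto simp: graphs_on_def)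
  obtain S where S: "S \<subseteq> U" "finite S" "card S = s + 1" "pairwise_adjacent (edges G) S"
    using has_clique_if_s_independence_number_less[OF fin G(3) less U] unfolding has_clique_def by blast
  have no_loop: "{x, x} \<notin> edges G" for x
    using G(1) by (auto simp: graphs_on_def nsets_def)
  let ?W = "common_neighbours G S"
  have W: "?W \<subseteq> verts G" by (auto simp: common_neighbours_def)
  have "\<not> has_clique s (edges G) ?W"
  proof
    assume "has_clique s (edges G) ?W"
    then have "has_clique (s + 1 + s) (edges G) (S \<union> ?W)"
    proof (rule has_clique_Un[OF S(2-4)])
      fix x y assume xy: "x \<in> S" "y \<in> ?W"
      then have "{x, y} \<in> edges G" by (auto simp: common_neighbours_def insert_commute)
      then show "x \<noteq> y \<and> {x, y} \<in> edges G" using no_loop[of x] by auto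
    qed
    then have "has_clique (s + 1 + s) (edges G) (verts G)"
      by (rule has_clique_mono) (use S U W in auto)
    moreover have "s + 1 + s = 2 * s + 1" by simp
    ultimately show False using G(2) by (metis contains_copy_complete_graph_iff)
  qed
  then have "card ?W \<le> erdos_rogers s (s + 1) m"
    using card_le_s_independence_number[OF fin W] less by fastforce
  then show ?thesis using S by blast
qed

text \<open>The least suitable N works, as s^(N-1) is still below n. It serves as the word length
  for a given n.\<close>

lemma ex_power_between:
  fixes s n :: nat
  assumes "2 \<le> s" "0 < n"
  shows "\<exists>N. n \<le> s ^ N \<and> s ^ N \<le> s * n"
proof -
  have ex: "\<exists>N. n \<le> s ^ N"
    using assms by (metis less_exp less_imp_le order_trans power_mono zero_le_numeral)
  define N where "N = (LEAST N. n \<le> s ^ N)"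
  have "n \<le> s ^ N" unfolding N_def using ex by (rule LeastI_ex)
  moreover have "s ^ N \<le> s * n"
  proof (cases N)
    case 0
    then show ?thesis using assms by simp
  next
    case (Suc M)
    then have "\<not> n \<le> s ^ M" unfolding N_def using not_less_Least by (metis lessI)
    then show ?thesis using Suc by simp
  qed
  ultimately show ?thesis by blast
qed

theorem theorem7p1:
  fixes s :: nat and \<omega> :: "nat \<Rightarrow> real"
  assumes "s \<ge> 2"
    and "filterlim \<omega> at_top sequentially"
  shows "(\<lambda>n. real (RT s n (complete_graph (2 * s + 1))
                 (real (erdos_rogers s (s + 1) (nat \<lfloor>real n / \<omega> n\<rfloor>)))))
           \<in> o(\<lambda>n. (real n)\<^sup>2)"
proof (rule landau_o.smallI)
  fix c :: real assume "0 < c"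
  \<comment> \<open>\<open>dependent_random_choice\<close> asks for \<open>2 * d * n^2\<close>
    edges.\<close>
  define d where "d = c / 2"
  have "0 < d" using \<open>0 < c\<close> by (simp add: d_def)
  obtain \<rho> :: real where \<rho>: "0 < \<rho>" "\<rho> < 1"
    and er: "\<And>N m. m \<le> s ^ N \<Longrightarrow> erdos_rogers s (s + 1) m \<le> s * \<rho> ^ N * real s ^ N"
    using erdos_rogers_exponential_saving[OF assms(1)] by blast
  \<comment> \<open>\<open>D ^ N\<close> bounds the number \<open>n ^ (s + 1)\<close> of choices for
    S when \<open>n \<le> s ^ N\<close>; t is then taken so large that \<open>D * \<rho> ^ t\<close>
    is below 1/2.\<close>
  define D where "D = real s ^ (s + 1)"
  have "0 < D" using assms(1) by (simp add: D_def)
  obtain t where t: "\<rho> ^ t < 1 / (2 * D)"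
    using real_arch_pow_inv[of "1 / (2 * D)" \<rho>] \<rho> \<open>0 < D\<close> by auto
  define \<epsilon> where "\<epsilon> = d ^ (t + 1) / 2"
  have "0 < \<epsilon>" using \<open>0 < d\<close> by (simp add: \<epsilon>_def)
  \<comment> \<open>\<open>M\<close> collects the constants in \<open>b ^ t\<close>, since
    \<open>b \<le> s^2 * \<rho> ^ N * n\<close>.\<close>
  define M where "M = real s ^ (2 * t)"
  have "0 < M" using assms(1) by (simp add: M_def)
  obtain N0 where N0: "(1 / 2) ^ N0 < \<epsilon> / M"
    using real_arch_pow_inv[of "\<epsilon> / M" "1 / 2 :: real"] \<open>0 < \<epsilon>\<close> \<open>0 < M\<close> by auto
  \<comment> \<open>The bounds on \<open>\<omega>\<close> give \<open>m \<le> n\<close> and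
    \<open>m \<le> \<epsilon> * n\<close>; a large n forces the word length above
    \<open>N0\<close>.\<close>
  have "eventually (\<lambda>n. max 1 (1 / \<epsilon>) \<le> \<omega> n) sequentially"
    using assms(2) unfolding filterlim_at_top by blast
  moreover have "eventually (\<lambda>n. s ^ N0 < n) sequentially" by (rule eventually_gt_at_top)
  ultimately show "eventually (\<lambda>n. norm (real (RT s n (complete_graph (2 * s + 1))
      (real (erdos_rogers s (s + 1) (nat \<lfloor>real n / \<omega> n\<rfloor>))))) \<le> c * norm ((real n)\<^sup>2)) sequentially"
  proof eventually_elim
    case (elim n)
    define m where "m = nat \<lfloor>real n / \<omega> n\<rfloor>"
    define b where "b = erdos_rogers s (s + 1) m"
    define A where "A = {G \<in> graphs_on n. \<not> contains_copy G (complete_graph (2 * s + 1)) \<and>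
      real (s_independence_number s G) < real b}"
    have "0 < n" using elim(2) by simp
    have \<omega>: "1 \<le> \<omega> n" "1 / \<epsilon> \<le> \<omega> n" using elim(1) by auto
    have "real m \<le> real n / \<omega> n" using \<omega>(1) by (simp add: m_def of_nat_floor)
    moreover have "real n / \<omega> n \<le> real n / 1" using \<omega>(1) by (intro divide_left_mono) auto
    moreover have "real n / \<omega> n \<le> real n / (1 / \<epsilon>)"
      using \<omega> \<open>0 < \<epsilon>\<close> by (intro divide_left_mono) auto
    ultimately have m: "m \<le> n" "real m \<le> \<epsilon> * n" by (auto simp: mult.commute)
    have few: "card (edges G) \<le> c * (real n)\<^sup>2" if "G \<in> A" for G
    proof (rule ccontr)
      assume "\<not> ?thesis"
      then have E: "2 * d * (real n)\<^sup>2 \<le> card (edges G)" by (simp add: d_def)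
      have G: "verts G = {..<n}" "edges G \<subseteq> nsets (verts G) 2"
        using that by (auto simp: A_def graphs_on_def)
      have "\<epsilon> * real n ^ t \<le> real n ^ (s + 1) * real b ^ t"
        unfolding \<epsilon>_def
      proof (rule dependent_random_choice[of G])
        show "real m \<le> d ^ (t + 1) * n / 2" using m(2) by (simp add: \<epsilon>_def)
        show "\<exists>S\<subseteq>U. card S = s + 1 \<and> finite S \<and> card (common_neighbours G S) \<le> b"
          if "U \<subseteq> verts G" "m \<le> card U" for U
          unfolding b_def using that \<open>G \<in> A\<close> assms(1)
          by (intro few_common_neighbours_if_no_clique[of G n]) (auto simp: A_def b_def)
      qed (use G E \<open>0 < n\<close> \<open>0 < d\<close> in auto)
      also have "\<dots> \<le> M * (1 / 2) ^ N0 * real n ^ t"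
      proof -
        obtain N where N: "n \<le> s ^ N" "s ^ N \<le> s * n"
          using ex_power_between[OF assms(1) \<open>0 < n\<close>] by blast
        have "s ^ N0 < s ^ N" using N(1) elim(2) by linarith
        then have "N0 < N" by (rule power_less_imp_less_exp[rotated]) (use assms(1) in simp)
        then have "N0 \<le> N" by simp
        have sN: "real s ^ N \<le> s * n" and nN: "real n \<le> real s ^ N"
          using N of_nat_mono[OF N(1), where 'a = real] of_nat_mono[OF N(2), where 'a = real] by auto
        have "real b \<le> s * \<rho> ^ N * real s ^ N" unfolding b_def using er m(1) N(1) by simp
        also have "\<dots> \<le> s * \<rho> ^ N * (s * n)" using sN \<rho>(1) by (intro mult_left_mono) auto
        finally have "real b ^ t \<le> (s * \<rho> ^ N * (s * n)) ^ t" by (intro power_mono) auto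
        moreover have "real n ^ (s + 1) \<le> (real s ^ N) ^ (s + 1)" using nN by (intro power_mono) auto
        ultimately have "real n ^ (s + 1) * real b ^ t
            \<le> (real s ^ N) ^ (s + 1) * (s * \<rho> ^ N * (s * n)) ^ t"
          by (intro mult_mono) auto
        also have "\<dots> = M * (D * \<rho> ^ t) ^ N * real n ^ t"
        proof -
          have "(real s ^ N) ^ (s + 1) = D ^ N"
            unfolding D_def power_mult[symmetric] by (simp only: mult.commute)
          moreover have "(s * \<rho> ^ N * (s * n)) ^ t = M * (\<rho> ^ t) ^ N * real n ^ t"
          proof -
            have "s * \<rho> ^ N * (s * n) = (real s)\<^sup>2 * \<rho> ^ N * n" by (simp add: power2_eq_square)
            then have "(s * \<rho> ^ N * (s * n)) ^ t = ((real s)\<^sup>2) ^ t * (\<rho> ^ N) ^ t * real n ^ t"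
              by (simp only: power_mult_distrib)
            moreover have "((real s)\<^sup>2) ^ t = M" by (simp only: M_def power_mult)
            moreover have "(\<rho> ^ N) ^ t = (\<rho> ^ t) ^ N"
              unfolding power_mult[symmetric] by (simp only: mult.commute)
            ultimately show ?thesis by simp
          qed
          ultimately show ?thesis by (simp only: power_mult_distrib mult_ac)
        qed
        also have "\<dots> \<le> M * (1 / 2) ^ N0 * real n ^ t"
        proof -
          have "D * \<rho> ^ t \<le> 1 / 2" using t \<open>0 < D\<close> by (simp add: field_simps)
          then have "(D * \<rho> ^ t) ^ N \<le> (1 / 2) ^ N"
            using \<open>0 < D\<close> \<rho>(1) by (intro power_mono) auto
          also have "\<dots> \<le> (1 / 2) ^ N0" using \<open>N0 \<le> N\<close> by (intro power_decreasing) auto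
          finally show ?thesis using \<open>0 < M\<close> by (intro mult_right_mono mult_left_mono) auto
        qed
        finally show ?thesis .
      qed
      also have "\<dots> < \<epsilon> * real n ^ t"
        using N0 \<open>0 < M\<close> \<open>0 < n\<close> by (simp add: field_simps)
      finally show False by simp
    qed
    have "finite A" using finite_graphs_on by (simp add: A_def)
    have "Max ((\<lambda>G. card (edges G)) ` A) \<le> c * (real n)\<^sup>2" if "A \<noteq> {}"
    proof -
      have "Max ((\<lambda>G. card (edges G)) ` A) \<in> (\<lambda>G. card (edges G)) ` A"
        using \<open>finite A\<close> that by (intro Max_in) auto
      then obtain G where "G \<in> A" "Max ((\<lambda>G. card (edges G)) ` A) = card (edges G)" by blast
      then show ?thesis using few by simp
    qed
    \<comment> \<open>If \<open>A\<close> is empty, the value is 0 and the bound follows from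
      \<open>0 < c\<close>.\<close>
    then have "real (RT s n (complete_graph (2 * s + 1)) (real b)) \<le> c * (real n)\<^sup>2"
      using \<open>0 < c\<close> unfolding RT_def Let_def A_def[symmetric] by auto
    then show ?case by (simp add: b_def m_def)
  qed
qed

end
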